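(* Let $\mathscr{H}$ be a linearly ordered complete Heyting algebra, and let $\mathfrak{M}=(W,\{R_i\}_{i\in I},V)$ and $\mathfrak{M}'=(W',\{R_i'\}_{i\in I},V')$ be two image-finite fuzzy Kripke models over $\mathscr{H}$. Let $\Phi^{+}$ be the set of plus-formulae. Then: (1) the greatest weak prebisimulation for the set $\Phi^{+}$ between $\mathfrak{M}$ and $\mathfrak{M}'$, if it exists, is the greatest forward prebisimulation between $\mathfrak{M}$ and $\mathfrak{M}'$; (2) the greatest weak bisimulation for the set $\Phi^{+}$ between $\mathfrak{M}$ and $\mathfrak{M}'$, if it exists, is the greatest forward bisimulation between $\mathfrak{M}$ and $\mathfrak{M}'$.
   Context: Let $\mathscr{H}=(H,\wedge,\vee,\rightarrow,0,1)$ be a complete Heyting algebra ($x\wedge y\leqslant z\Leftrightarrow x\leqslant y\rightarrow z$). Fuzzy sets and relations. A fuzzy subset of $A$ is a function $A\to H$; a fuzzy relation between $A$ and $B$ is a function $A\times B\to H$, and a fuzzy relation on $A$ is a function $A\times A\to H$. Order, joins and meets are pointwise; "greatest" refers to the pointwise order. A fuzzy relation is non-empty if it is not identically $0$. The inverse is $\varphi^{-1}(b,a)=\varphi(a,b)$. Compositions: $(\varphi\circ\psi)(a,c)=\bigvee_{b\in B}\varphi(a,b)\wedge\psi(b,c)$; for fuzzy subsets $f$ of $A$ and $g$ of $B$ and a fuzzy relation $\varphi$ between $A$ and $B$, $(f\circ\varphi)(b)=\bigvee_{a\in A}f(a)\wedge\varphi(a,b)$ and $(\varphi\circ g)(a)=\bigvee_{b\in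 B}\varphi(a,b)\wedge g(b)$. Language. Let $I$ be a finite index set and $PV$ a set of proposition letters. The set $\Phi$ of all modal formulae is given by the grammar $A::=\overline{t}\mid p\mid A\wedge A\mid A\rightarrow A\mid\square_iA\mid\lozenge_iA\mid\square_i^{-}A\mid\lozenge_i^{-}A$, where $i\in I$, $p\in PV$, and $\overline{t}$ is a truth constant, one for each $t\in H$. The set $\Phi^{+}$ of plus-formulae consists of the formulae in $\Phi$ containing none of the operators $\square_i^{-},\lozenge_i^{-}$ ($i\in I$). Models. A fuzzy Kripke model over $\mathscr{H}$ is $\mathfrak{M}=(W,\{R_i\}_{i\in I},V)$ with $W$ a non-empty set, each $R_i$ a fuzzy relation on $W$, and $V$ assigning a value $V(w,p)\in H$ to each $w\in W$, $p\in PV$, with $V(w,\overline{t})=t$. $V$ is extended to all formulae by $V(w,A\wedge B)=V(w,A)\wedge V(w,B)$; $V(w,A\rightarrow B)=V(w,A)\rightarrow V(w,B)$; $V(w,\square_iA)=\bigwedge_{u\in W}(R_i(w,u)\rightarrow V(u,A))$; $V(w,\lozenge_iA)=\bigvee_{u\in W}(R_i(w,u)\wedge V(u,A))$; $V(w,\square_i^{-}A)=\bigwedge_{u\in W}(R_i(u,w)\rightarrow V(u,A))$; $V(w,\lozenge_i^{-}A)=\bigvee_{u\in W}(R_i(u,w)\wedge V(u,A))$. Write $V_A(w)=V(w,A)$, so $V_A$ is a fuzzy subset of $W$. The model is image-finite if for all $i\in I$ and $w\in W$ the set $\{u\in W\mid R_i(w,u)>0\}$ is finite. Both models are over the same $\mathscr{H}$,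 $I$ and $PV$. Let $\varphi$ be a non-empty fuzzy relation between $W$ and $W'$. $\varphi$ is a forward bisimulation between $\mathfrak{M}$ and $\mathfrak{M}'$ if: (fb-1) $V_p\leqslant V_p'\circ\varphi^{-1}$ and $V_p'\leqslant V_p\circ\varphi$ for every $p\in PV$; (fb-2) $\varphi^{-1}\circ R_i\leqslant R_i'\circ\varphi^{-1}$ and $\varphi\circ R_i'\leqslant R_i\circ\varphi$ for every $i\in I$; (fb-3) $\varphi^{-1}\circ V_p\leqslant V_p'$ and $\varphi\circ V_p'\leqslant V_p$ for every $p\in PV$. It is a forward prebisimulation if it satisfies (fb-2) and (fb-3). For a non-empty set $\Psi$ of formulae, $\varphi$ is a weak bisimulation for $\Psi$ if: (wb-1) $V_p\leqslant V_p'\circ\varphi^{-1}$ and $V_p'\leqslant V_p\circ\varphi$ for every $p\in PV$; (wb-2) $\varphi^{-1}\circ V_A\leqslant V_A'$ and $\varphi\circ V_A'\leqslant V_A$ for every $A\in\Psi$. It is a weak prebisimulation for $\Psi$ if it satisfies (wb-2). *)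

theory Defs
  imports Main
begin

text \<open>\<open>0\<close> and \<open>1\<close> are \<open>bot\<close> and \<open>top\<close>. The library's \<open>complete_distrib_lattice\<close> is completely
  distributive, hence too strong to stand for complete Heyting algebras in general.\<close>

class complete_heyting_algebra = complete_lattice +
  fixes himp :: "'a \<Rightarrow> 'a \<Rightarrow> 'a"  (infixr "\<leadsto>" 60)
  assumes himp_residuation: "inf x y \<le> z \<longleftrightarrow> x \<le> (y \<leadsto> z)"

text \<open>Fuzzy relations are curried, so that the library order on functions is the pointwise order.\<close>

type_synonym ('a, 'h) fset = "'a \<Rightarrow> 'h"
type_synonym ('a, 'b, 'h) frel = "'a \<Rightarrow> 'b \<Rightarrow> 'h"

definition nonempty_frel :: "('a, 'b, 'h::complete_lattice) frel \<Rightarrow> bool" where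
  "nonempty_frel \<phi> \<longleftrightarrow> (\<exists>a b. \<phi> a b \<noteq> bot)"

definition finv :: "('a, 'b, 'h) frel \<Rightarrow> ('b, 'a, 'h) frel" where
  "finv \<phi> = (\<lambda>b a. \<phi> a b)"

definition comp_rr :: "('a, 'b, 'h::complete_lattice) frel \<Rightarrow> ('b, 'c, 'h) frel \<Rightarrow> ('a, 'c, 'h) frel"
    (infixl "\<circ>\<^sub>r\<^sub>r" 75) where
  "\<phi> \<circ>\<^sub>r\<^sub>r \<psi> = (\<lambda>a c. SUP b. inf (\<phi> a b) (\<psi> b c))"

definition comp_sr :: "('a, 'h::complete_lattice) fset \<Rightarrow> ('a, 'b, 'h) frel \<Rightarrow> ('b, 'h) fset"
    (infixl "\<circ>\<^sub>s\<^sub>r" 75) where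
  "f \<circ>\<^sub>s\<^sub>r \<phi> = (\<lambda>b. SUP a. inf (f a) (\<phi> a b))"

definition comp_rs :: "('a, 'b, 'h::complete_lattice) frel \<Rightarrow> ('b, 'h) fset \<Rightarrow> ('a, 'h) fset"
    (infixl "\<circ>\<^sub>r\<^sub>s" 75) where
  "\<phi> \<circ>\<^sub>r\<^sub>s g = (\<lambda>a. SUP b. inf (\<phi> a b) (g b))"

datatype (indices: 'i, letters: 'p, constants: 'h) form =
    Const 'h
  | Letter 'p
  | And "('i, 'p, 'h) form" "('i, 'p, 'h) form"
  | Imp "('i, 'p, 'h) form" "('i, 'p, 'h) form"
  | Box 'i "('i, 'p, 'h) form"
  | Dia 'i "('i, 'p, 'h) form"
  | BoxInv 'i "('i, 'p, 'h) form"
  | DiaInv 'i "('i, 'p, 'h) form"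

text \<open>The index set \<open>I\<close> and the set \<open>PV\<close> of letters are explicit sets, since a type could not be
  empty; formulae are restricted to those over \<open>I\<close> and \<open>PV\<close>.\<close>

definition formulae :: "'i set \<Rightarrow> 'p set \<Rightarrow> ('i, 'p, 'h) form set" where
  "formulae I PV = {A. indices A \<subseteq> I \<and> letters A \<subseteq> PV}"

primrec inverse_free :: "('i, 'p, 'h) form \<Rightarrow> bool" where
  "inverse_free (Const t) \<longleftrightarrow> True"
| "inverse_free (Letter p) \<longleftrightarrow> True"
| "inverse_free (And A B) \<longleftrightarrow> inverse_free A \<and> inverse_free B"
| "inverse_free (Imp A B) \<longleftrightarrow> inverse_free A \<and> inverse_free B"
| "inverse_free (Box i A) \<longleftrightarrow> inverse_free A"
| "inverse_free (Dia i A) \<longleftrightarrow> inverse_free A"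
| "inverse_free (BoxInv i A) \<longleftrightarrow> False"
| "inverse_free (DiaInv i A) \<longleftrightarrow> False"

definition plus_formulae :: "'i set \<Rightarrow> 'p set \<Rightarrow> ('i, 'p, 'h) form set" where
  "plus_formulae I PV = {A \<in> formulae I PV. inverse_free A}"

text \<open>The set of worlds is the type \<open>'w\<close>, which is automatically non-empty. Values of \<open>rel\<close> outside
  \<open>I\<close> and of \<open>val\<close> outside \<open>PV\<close> are never consulted.\<close>

record ('w, 'i, 'p, 'h) kripke =
  rel :: "'i \<Rightarrow> ('w, 'w, 'h) frel"
  val :: "'w \<Rightarrow> 'p \<Rightarrow> 'h"

text \<open>\<open>truth M A\<close> is the fuzzy subset \<open>V\<^sub>A\<close> of worlds.\<close>

primrec truth :: "('w, 'i, 'p, 'h::complete_heyting_algebra) kripke \<Rightarrow> ('i, 'p, 'h) form \<Rightarrow> ('w, 'h) fset"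
  where
  "truth M (Const t) = (\<lambda>w. t)"
| "truth M (Letter p) = (\<lambda>w. val M w p)"
| "truth M (And A B) = (\<lambda>w. inf (truth M A w) (truth M B w))"
| "truth M (Imp A B) = (\<lambda>w. truth M A w \<leadsto> truth M B w)"
| "truth M (Box i A) = (\<lambda>w. INF u. rel M i w u \<leadsto> truth M A u)"
| "truth M (Dia i A) = (\<lambda>w. SUP u. inf (rel M i w u) (truth M A u))"
| "truth M (BoxInv i A) = (\<lambda>w. INF u. rel M i u w \<leadsto> truth M A u)"
| "truth M (DiaInv i A) = (\<lambda>w. SUP u. inf (rel M i u w) (truth M A u))"

definition image_finite :: "'i set \<Rightarrow> ('w, 'i, 'p, 'h::complete_heyting_algebra) kripke \<Rightarrow> bool" where
  "image_finite I M \<longleftrightarrow> (\<forall>i\<in>I. \<forall>w. finite {u. rel M i w u > bot})"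

definition forward_prebisimulation ::
  "'i set \<Rightarrow> 'p set \<Rightarrow> ('w, 'i, 'p, 'h::complete_heyting_algebra) kripke \<Rightarrow> ('v, 'i, 'p, 'h) kripke
    \<Rightarrow> ('w, 'v, 'h) frel \<Rightarrow> bool" where
  "forward_prebisimulation I PV M M' \<phi> \<longleftrightarrow> nonempty_frel \<phi> \<and>
    (\<forall>i\<in>I. finv \<phi> \<circ>\<^sub>r\<^sub>r rel M i \<le> rel M' i \<circ>\<^sub>r\<^sub>r finv \<phi> \<and>
           \<phi> \<circ>\<^sub>r\<^sub>r rel M' i \<le> rel M i \<circ>\<^sub>r\<^sub>r \<phi>) \<and>
    (\<forall>p\<in>PV. finv \<phi> \<circ>\<^sub>r\<^sub>s truth M (Letter p) \<le> truth M' (Letter p) \<and>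
            \<phi> \<circ>\<^sub>r\<^sub>s truth M' (Letter p) \<le> truth M (Letter p))"

definition forward_bisimulation ::
  "'i set \<Rightarrow> 'p set \<Rightarrow> ('w, 'i, 'p, 'h::complete_heyting_algebra) kripke \<Rightarrow> ('v, 'i, 'p, 'h) kripke
    \<Rightarrow> ('w, 'v, 'h) frel \<Rightarrow> bool" where
  "forward_bisimulation I PV M M' \<phi> \<longleftrightarrow> forward_prebisimulation I PV M M' \<phi> \<and>
    (\<forall>p\<in>PV. truth M (Letter p) \<le> truth M' (Letter p) \<circ>\<^sub>s\<^sub>r finv \<phi> \<and>
            truth M' (Letter p) \<le> truth M (Letter p) \<circ>\<^sub>s\<^sub>r \<phi>)"

definition weak_prebisimulation ::
  "('i, 'p, 'h) form set \<Rightarrow> ('w, 'i, 'p, 'h::complete_heyting_algebra) kripke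
    \<Rightarrow> ('v, 'i, 'p, 'h) kripke \<Rightarrow> ('w, 'v, 'h) frel \<Rightarrow> bool" where
  "weak_prebisimulation \<Psi> M M' \<phi> \<longleftrightarrow> nonempty_frel \<phi> \<and>
    (\<forall>A\<in>\<Psi>. finv \<phi> \<circ>\<^sub>r\<^sub>s truth M A \<le> truth M' A \<and> \<phi> \<circ>\<^sub>r\<^sub>s truth M' A \<le> truth M A)"

definition weak_bisimulation ::
  "'p set \<Rightarrow> ('i, 'p, 'h) form set \<Rightarrow> ('w, 'i, 'p, 'h::complete_heyting_algebra) kripke
    \<Rightarrow> ('v, 'i, 'p, 'h) kripke \<Rightarrow> ('w, 'v, 'h) frel \<Rightarrow> bool" where
  "weak_bisimulation PV \<Psi> M M' \<phi> \<longleftrightarrow> weak_prebisimulation \<Psi> M M' \<phi> \<and>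
    (\<forall>p\<in>PV. truth M (Letter p) \<le> truth M' (Letter p) \<circ>\<^sub>s\<^sub>r finv \<phi> \<and>
            truth M' (Letter p) \<le> truth M (Letter p) \<circ>\<^sub>s\<^sub>r \<phi>)"

definition is_greatest :: "('a::order \<Rightarrow> bool) \<Rightarrow> 'a \<Rightarrow> bool" where
  "is_greatest P x \<longleftrightarrow> P x \<and> (\<forall>y. P y \<longrightarrow> y \<le> x)"

lemma plus_formulae_nonempty: "Const t \<in> plus_formulae I PV"
  by (simp add: plus_formulae_def formulae_def)

end

theory Submission
  imports Defs
begin

text \<open>
  For a set \<open>\<Psi>\<close> of formulae, the degree to which a world \<open>a\<close> of \<open>M\<close> and a world \<open>b\<close> of \<open>M'\<close> agree
  on \<open>\<Psi>\<close> is the infimum of the biimplications of their truth values. By residuation, the weak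
  prebisimulations for \<open>\<Psi>\<close> are exactly the non-empty fuzzy relations below this degree of agreement
  (\<open>weak_prebisimulation_iff\<close>), and enlarging a relation preserves the two conditions that
  distinguish bisimulations from prebisimulations. Hence a greatest weak prebisimulation, as well as
  a greatest weak bisimulation, can only be the degree of agreement itself.

  It remains to compare this relation with forward (pre)bisimulations. In one direction, an induction
  on plus-formulae shows that every forward prebisimulation lies below the degree of agreement
  (\<open>forward_imp_weak_prebisimulation\<close>). In the other direction, a Hennessy--Milner argument shows that the degree of agreement on plus-formulae has the
  back-and-forth property (\<open>agreement_forth\<close>). Suppose that \<open>a\<close> and \<open>b\<close> agree to degree at least
  \<open>t > \<bottom>\<close>, that \<open>c\<close> is an \<open>R\<close>-successor of \<open>a\<close> to degree at least \<open>t\<close>, and that no successor of \<open>b\<close>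
  matches \<open>c\<close> to degree \<open>t\<close>. As the order is linear, each of the finitely many worlds \<open>d\<close> with
  \<open>R' b d > \<bottom>\<close> either has \<open>R' b d < t\<close> or agrees with \<open>c\<close> to degree less than \<open>t\<close>, as witnessed by
  a formula \<open>A\<close>. The formula stating that \<open>A\<close> is equivalent to the truth constant \<open>V\<^sub>A(c)\<close> then has
  value \<open>1\<close> at \<open>c\<close> and value below \<open>t\<close> at \<open>d\<close>. The conjunction \<open>B\<close> of these formulae has value \<open>1\<close>
  at \<open>c\<close>, so \<open>\<diamond>B\<close> has value at least \<open>t\<close> at \<open>a\<close>; at \<open>b\<close> it is the supremum of \<open>\<bottom>\<close> and finitely
  many values below \<open>t\<close>, hence below \<open>t\<close> by linearity. This contradicts the agreement of \<open>a\<close> and \<open>b\<close>.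
\<close>

section \<open>Residuation\<close>

lemma himp_modus_ponens: "inf x (x \<leadsto> y) \<le> (y :: 'h::complete_heyting_algebra)"
  using himp_residuation[of "x \<leadsto> y" x y] by (simp add: inf_commute)

lemma himp_refl: "(x \<leadsto> x) = (top :: 'h::complete_heyting_algebra)"
  using himp_residuation[of top x x] by (simp add: top_unique)

text \<open>Meets distribute over arbitrary joins because \<open>inf x\<close> has the upper adjoint \<open>x \<leadsto> _\<close>.\<close>

lemma inf_SUP_le_iff:
  fixes x z :: "'h::complete_heyting_algebra"
  shows "inf x (SUP u. f u) \<le> z \<longleftrightarrow> (\<forall>u. inf x (f u) \<le> z)"
proof -
  have "inf x (SUP u. f u) \<le> z \<longleftrightarrow> (SUP u. f u) \<le> (x \<leadsto> z)"
    by (simp add: inf_commute flip: himp_residuation)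
  also have "\<dots> \<longleftrightarrow> (\<forall>u. f u \<le> (x \<leadsto> z))"
    by (simp add: SUP_le_iff)
  finally show ?thesis
    by (simp add: inf_commute flip: himp_residuation)
qed

definition biimp :: "'h::complete_heyting_algebra \<Rightarrow> 'h \<Rightarrow> 'h" where
  "biimp x y = inf (x \<leadsto> y) (y \<leadsto> x)"

lemma le_biimp_iff: "c \<le> biimp x y \<longleftrightarrow> inf c x \<le> y \<and> inf c y \<le> x"
  by (simp add: biimp_def himp_residuation)

lemma biimp_commute: "biimp x y = biimp y x"
  by (simp add: biimp_def inf_commute)

lemma biimp_refl: "biimp x x = top"
  by (simp add: biimp_def himp_refl)

section \<open>Agreement and weak bisimulations\<close>

definition agreement ::
  "('i, 'p, 'h) form set \<Rightarrow> ('w, 'i, 'p, 'h::complete_heyting_algebra) kripke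
    \<Rightarrow> ('v, 'i, 'p, 'h) kripke \<Rightarrow> ('w, 'v, 'h) frel" where
  "agreement \<Psi> M M' = (\<lambda>a b. INF A\<in>\<Psi>. biimp (truth M A a) (truth M' A b))"

lemma finv_finv [simp]: "finv (finv \<phi>) = \<phi>"
  by (simp add: finv_def)

lemma finv_agreement: "finv (agreement \<Psi> M M') = agreement \<Psi> M' M"
  by (simp add: finv_def agreement_def biimp_commute)

lemma agreement_preserves_truth:
  assumes "A \<in> \<Psi>"
  shows "inf (agreement \<Psi> M M' a b) (truth M A a) \<le> truth M' A b"
proof -
  have "agreement \<Psi> M M' a b \<le> biimp (truth M A a) (truth M' A b)"
    unfolding agreement_def using assms by (rule INF_lower)
  then show ?thesis
    by (simp add: le_biimp_iff)
qed

lemma comp_rs_le_iff: "\<phi> \<circ>\<^sub>r\<^sub>s g \<le> f \<longleftrightarrow> (\<forall>a b. inf (\<phi> a b) (g b) \<le> f a)"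
  by (simp add: comp_rs_def le_fun_def SUP_le_iff)

lemma comp_rs_le_both_iff:
  fixes \<phi> :: "('a, 'b, 'h::complete_heyting_algebra) frel"
  shows "finv \<phi> \<circ>\<^sub>r\<^sub>s f \<le> g \<and> \<phi> \<circ>\<^sub>r\<^sub>s g \<le> f \<longleftrightarrow> (\<forall>a b. \<phi> a b \<le> biimp (f a) (g b))"
  by (auto simp: comp_rs_le_iff finv_def le_biimp_iff)

lemma weak_prebisimulation_iff:
  "weak_prebisimulation \<Psi> M M' \<phi> \<longleftrightarrow> nonempty_frel \<phi> \<and> \<phi> \<le> agreement \<Psi> M M'"
  unfolding weak_prebisimulation_def comp_rs_le_both_iff
  by (auto simp: agreement_def le_fun_def le_INF_iff)

lemma nonempty_frel_mono: "nonempty_frel \<phi> \<Longrightarrow> \<phi> \<le> \<psi> \<Longrightarrow> nonempty_frel \<psi>"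
  unfolding nonempty_frel_def le_fun_def by (metis bot.extremum_uniqueI)

lemma comp_sr_mono: "\<phi> \<le> \<psi> \<Longrightarrow> f \<circ>\<^sub>s\<^sub>r \<phi> \<le> f \<circ>\<^sub>s\<^sub>r \<psi>"
  by (auto simp: comp_sr_def le_fun_def intro!: SUP_mono' inf_mono)

lemma finv_mono: "\<phi> \<le> \<psi> \<Longrightarrow> finv \<phi> \<le> finv \<psi>"
  by (simp add: finv_def le_fun_def)

lemma greatest_weak_prebisimulation_eq_agreement:
  assumes "is_greatest (weak_prebisimulation \<Psi> M M') \<phi>"
  shows "\<phi> = agreement \<Psi> M M'"
proof (rule order.antisym)
  show le: "\<phi> \<le> agreement \<Psi> M M'"
    using assms by (simp add: is_greatest_def weak_prebisimulation_iff)
  have "nonempty_frel \<phi>"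
    using assms by (simp add: is_greatest_def weak_prebisimulation_iff)
  then have "nonempty_frel (agreement \<Psi> M M')"
    using le by (rule nonempty_frel_mono)
  then show "agreement \<Psi> M M' \<le> \<phi>"
    using assms by (simp add: is_greatest_def weak_prebisimulation_iff)
qed

lemma weak_bisimulation_agreement:
  assumes "weak_bisimulation PV \<Psi> M M' \<phi>"
  shows "weak_bisimulation PV \<Psi> M M' (agreement \<Psi> M M')"
proof -
  have pre: "nonempty_frel \<phi>" and le: "\<phi> \<le> agreement \<Psi> M M'"
    using assms by (auto simp: weak_bisimulation_def weak_prebisimulation_iff)
  show ?thesis
    using assms nonempty_frel_mono[OF pre le]
    unfolding weak_bisimulation_def weak_prebisimulation_iff
    by (auto intro: order.trans[OF _ comp_sr_mono[OF le]]
        order.trans[OF _ comp_sr_mono[OF finv_mono[OF le]]])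
qed

lemma greatest_weak_bisimulation_eq_agreement:
  assumes "is_greatest (weak_bisimulation PV \<Psi> M M') \<phi>"
  shows "\<phi> = agreement \<Psi> M M'"
proof (rule order.antisym)
  show "\<phi> \<le> agreement \<Psi> M M'"
    using assms by (simp add: is_greatest_def weak_bisimulation_def weak_prebisimulation_iff)
  show "agreement \<Psi> M M' \<le> \<phi>"
    using assms weak_bisimulation_agreement unfolding is_greatest_def by blast
qed

section \<open>Invariance of plus-formulae under forward prebisimulations\<close>

text \<open>The other half of the condition on accessibility relations is the same statement for \<open>finv \<phi>\<close>
  and the exchanged models, so that each transfer result is stated once and used in both
  directions.\<close>

lemma forth_iff:
  "finv \<phi> \<circ>\<^sub>r\<^sub>r R \<le> R' \<circ>\<^sub>r\<^sub>r finv \<phi>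
    \<longleftrightarrow> (\<forall>a b c. inf (\<phi> a b) (R a c) \<le> (SUP d. inf (R' b d) (\<phi> c d)))"
  by (auto simp: comp_rr_def finv_def le_fun_def SUP_le_iff)

lemma forth_preserves_diamond:
  fixes \<phi> :: "('w, 'v, 'h::complete_heyting_algebra) frel"
  assumes forth: "finv \<phi> \<circ>\<^sub>r\<^sub>r R \<le> R' \<circ>\<^sub>r\<^sub>r finv \<phi>"
    and f: "\<And>a b. inf (\<phi> a b) (f a) \<le> g b"
  shows "inf (\<phi> a b) (SUP u. inf (R a u) (f u)) \<le> (SUP d. inf (R' b d) (g d))"
  unfolding inf_SUP_le_iff
proof
  fix u
  have "inf (\<phi> a b) (inf (R a u) (f u)) = inf (f u) (inf (\<phi> a b) (R a u))"
    by (simp add: ac_simps)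
  also have "\<dots> \<le> inf (f u) (SUP d. inf (R' b d) (\<phi> u d))"
    using forth by (intro inf_mono order.refl) (simp add: forth_iff)
  also have "\<dots> \<le> (SUP d. inf (R' b d) (g d))"
    unfolding inf_SUP_le_iff
  proof
    fix d
    have "inf (f u) (inf (R' b d) (\<phi> u d)) = inf (R' b d) (inf (\<phi> u d) (f u))"
      by (simp add: ac_simps)
    also have "\<dots> \<le> inf (R' b d) (g d)"
      using f by (intro inf_mono order.refl)
    also have "\<dots> \<le> (SUP d. inf (R' b d) (g d))"
      by (rule SUP_upper) simp
    finally show "inf (f u) (inf (R' b d) (\<phi> u d)) \<le> (SUP d. inf (R' b d) (g d))" .
  qed
  finally show "inf (\<phi> a b) (inf (R a u) (f u)) \<le> (SUP d. inf (R' b d) (g d))" .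
qed

text \<open>A box is transferred from \<open>a\<close> to \<open>b\<close> by the condition in the opposite direction: every
  successor \<open>d\<close> of \<open>b\<close> has to be matched by a successor of \<open>a\<close>, at which the box can be used.\<close>

lemma back_preserves_box:
  fixes \<phi> :: "('w, 'v, 'h::complete_heyting_algebra) frel"
  assumes converse_forth: "\<phi> \<circ>\<^sub>r\<^sub>r R' \<le> R \<circ>\<^sub>r\<^sub>r \<phi>"
    and f: "\<And>a b. inf (\<phi> a b) (f a) \<le> g b"
  shows "inf (\<phi> a b) (INF u. R a u \<leadsto> f u) \<le> (INF d. R' b d \<leadsto> g d)"
proof (rule INF_greatest)
  fix d
  define box where "box = (INF u. R a u \<leadsto> f u)"
  have match: "inf (\<phi> a b) (R' b d) \<le> (SUP u. inf (R a u) (\<phi> u d))"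
    using converse_forth forth_iff[of "finv \<phi>" R' R] by (simp add: finv_def)
  have "inf (inf (\<phi> a b) box) (R' b d) = inf box (inf (\<phi> a b) (R' b d))"
    by (simp add: ac_simps)
  also have "\<dots> \<le> inf box (SUP u. inf (R a u) (\<phi> u d))"
    by (intro inf_mono order.refl match)
  also have "\<dots> \<le> g d"
    unfolding inf_SUP_le_iff
  proof
    fix u
    have "box \<le> (R a u \<leadsto> f u)"
      unfolding box_def by (rule INF_lower) simp
    then have "inf (R a u) box \<le> f u"
      by (metis himp_residuation inf_commute)
    then have "inf (\<phi> u d) (inf (R a u) box) \<le> inf (\<phi> u d) (f u)"
      by (intro inf_mono order.refl)
    also have "\<dots> \<le> g d"
      by (rule f)
    finally show "inf box (inf (R a u) (\<phi> u d)) \<le> g d"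
      by (simp add: ac_simps)
  qed
  finally show "inf (\<phi> a b) (INF u. R a u \<leadsto> f u) \<le> (R' b d \<leadsto> g d)"
    by (simp add: box_def flip: himp_residuation)
qed

lemma inf_inf_transfer:
  fixes c :: "'h::lattice"
  assumes "inf c x \<le> x'" and "inf c y \<le> y'"
  shows "inf c (inf x y) \<le> inf x' y'"
proof -
  have "inf c (inf x y) = inf (inf c x) (inf c y)"
    by (simp add: ac_simps)
  with inf_mono[OF assms] show ?thesis
    by simp
qed

lemma inf_himp_transfer:
  fixes c :: "'h::complete_heyting_algebra"
  assumes "inf c x' \<le> x" and "inf c y \<le> y'"
  shows "inf c (x \<leadsto> y) \<le> (x' \<leadsto> y')"
proof -
  have "inf (inf c (x \<leadsto> y)) x' = inf (inf c (inf c x')) (x \<leadsto> y)"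
    by (simp add: ac_simps)
  also have "\<dots> \<le> inf (inf c x) (x \<leadsto> y)"
    by (intro inf_mono order.refl assms(1))
  also have "\<dots> = inf c (inf x (x \<leadsto> y))"
    by (simp add: ac_simps)
  also have "\<dots> \<le> inf c y"
    by (intro inf_mono order.refl himp_modus_ponens)
  also note assms(2)
  finally show ?thesis
    unfolding himp_residuation .
qed

text \<open>Both directions have to be proved in the same induction, since implications reverse the
  direction of transfer.\<close>

lemma forward_preserves_truth:
  fixes \<phi> :: "('w, 'v, 'h::complete_heyting_algebra) frel"
  assumes "forward_prebisimulation I PV M M' \<phi>" and "A \<in> plus_formulae I PV"
  shows "inf (\<phi> a b) (truth M A a) \<le> truth M' A b \<and> inf (\<phi> a b) (truth M' A b) \<le> truth M A a"
  using assms(2)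
proof (induction A arbitrary: a b)
  case (Const t)
  then show ?case by simp
next
  case (Letter p)
  then have "p \<in> PV"
    by (simp add: plus_formulae_def formulae_def)
  then show ?case
    using assms(1) by (auto simp: forward_prebisimulation_def comp_rs_le_iff finv_def)
next
  case (And A B)
  then have "A \<in> plus_formulae I PV" "B \<in> plus_formulae I PV"
    by (auto simp: plus_formulae_def formulae_def)
  with And.IH show ?case
    unfolding truth.simps by (intro conjI inf_inf_transfer) auto
next
  case (Imp A B)
  then have "A \<in> plus_formulae I PV" "B \<in> plus_formulae I PV"
    by (auto simp: plus_formulae_def formulae_def)
  with Imp.IH show ?case
    by (simp add: inf_himp_transfer)
next
  case (Box i A)
  then have "A \<in> plus_formulae I PV" and "i \<in> I"
    by (auto simp: plus_formulae_def formulae_def)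
  note IH = Box.IH[OF this(1)]
  have forth: "finv \<phi> \<circ>\<^sub>r\<^sub>r rel M i \<le> rel M' i \<circ>\<^sub>r\<^sub>r finv \<phi>" and converse_forth: "\<phi> \<circ>\<^sub>r\<^sub>r rel M' i \<le> rel M i \<circ>\<^sub>r\<^sub>r \<phi>"
    using assms(1) \<open>i \<in> I\<close> by (auto simp: forward_prebisimulation_def)
  show ?case
    using back_preserves_box[OF converse_forth, of "truth M A" "truth M' A" a b]
      back_preserves_box[OF forth, of "truth M' A" "truth M A" b a] IH
    by (simp add: finv_def)
next
  case (Dia i A)
  then have "A \<in> plus_formulae I PV" and "i \<in> I"
    by (auto simp: plus_formulae_def formulae_def)
  note IH = Dia.IH[OF this(1)]
  have forth: "finv \<phi> \<circ>\<^sub>r\<^sub>r rel M i \<le> rel M' i \<circ>\<^sub>r\<^sub>r finv \<phi>"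
    and converse_forth: "finv (finv \<phi>) \<circ>\<^sub>r\<^sub>r rel M' i \<le> rel M i \<circ>\<^sub>r\<^sub>r finv (finv \<phi>)"
    using assms(1) \<open>i \<in> I\<close> by (auto simp: forward_prebisimulation_def)
  show ?case
    using forth_preserves_diamond[OF forth, of "truth M A" "truth M' A" a b]
      forth_preserves_diamond[OF converse_forth, of "truth M' A" "truth M A" b a] IH
    by (simp add: finv_def)
qed (auto simp: plus_formulae_def)

lemma forward_imp_weak_prebisimulation:
  assumes "forward_prebisimulation I PV M M' \<phi>"
  shows "weak_prebisimulation (plus_formulae I PV) M M' \<phi>"
  using assms forward_preserves_truth[OF assms]
  by (auto simp: weak_prebisimulation_def forward_prebisimulation_def comp_rs_le_iff finv_def)

section \<open>The Hennessy--Milner argument\<close>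

text \<open>The role of image-finiteness: in a linear order a supremum with finitely many non-zero terms is
  a maximum, so a bound reached by the supremum is reached by a single term.\<close>

lemma le_SUP_attained:
  fixes f :: "'a \<Rightarrow> 'h::complete_linorder"
  assumes "finite {d. f d > bot}" and "t > bot" and "t \<le> (SUP d. f d)"
  obtains d where "t \<le> f d"
proof (rule ccontr)
  assume "\<not> thesis"
  then have less: "f d < t" for d
    using that[of d] by (simp add: not_le[symmetric]) blast
  have "(SUP d. f d) \<le> Sup (insert bot (f ` {d. f d > bot}))"
    by (rule SUP_least, rule Sup_upper) (auto simp: less_le)
  also have "\<dots> < t"
    using assms(1,2) less by (subst finite_Sup_less_iff) auto
  finally show False
    using assms(3) by simp
qed

text \<open>Truth constants let a formula name the value \<open>t\<close>: it measures how close \<open>A\<close> is to \<open>t\<close>.\<close>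

definition has_value :: "('i, 'p, 'h) form \<Rightarrow> 'h \<Rightarrow> ('i, 'p, 'h) form" where
  "has_value A t = And (Imp A (Const t)) (Imp (Const t) A)"

lemma truth_has_value: "truth M (has_value A t) w = biimp (truth M A w) t"
  by (simp add: has_value_def biimp_def)

definition Conj :: "('i, 'p, 'h::complete_lattice) form list \<Rightarrow> ('i, 'p, 'h) form" where
  "Conj As = foldr And As (Const top)"

lemma truth_Conj: "truth M (Conj As) w = (INF A\<in>set As. truth M A w)"
  by (induction As) (simp_all add: Conj_def)

lemma has_value_plus: "A \<in> plus_formulae I PV \<Longrightarrow> has_value A t \<in> plus_formulae I PV"
  by (simp add: has_value_def plus_formulae_def formulae_def)

lemma Conj_plus: "set As \<subseteq> plus_formulae I PV \<Longrightarrow> Conj As \<in> plus_formulae I PV"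
  by (induction As) (auto simp: Conj_def plus_formulae_def formulae_def)

text \<open>Finitely many worlds can be separated from \<open>c\<close> by one plus-formula that is fully true at \<open>c\<close>.\<close>

lemma characteristic_formula:
  fixes M :: "('w, 'i, 'p, 'h::{complete_heyting_algebra, complete_linorder}) kripke"
  assumes "finite D" and less: "\<And>d. d \<in> D \<Longrightarrow> agreement (plus_formulae I PV) M M' c d < t"
  obtains B where "B \<in> plus_formulae I PV" and "truth M B c = top"
    and "\<And>d. d \<in> D \<Longrightarrow> truth M' B d < t"
proof -
  have "\<exists>A\<in>plus_formulae I PV. biimp (truth M A c) (truth M' A d) < t" if "d \<in> D" for d
    using less[OF that] by (simp add: agreement_def INF_less_iff)
  then obtain A where A: "\<And>d. d \<in> D \<Longrightarrow> A d \<in> plus_formulae I PV"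
      "\<And>d. d \<in> D \<Longrightarrow> biimp (truth M (A d) c) (truth M' (A d) d) < t"
    by metis
  obtain ds where ds: "set ds = D"
    using \<open>finite D\<close> finite_list by blast
  define B where "B = Conj (map (\<lambda>d. has_value (A d) (truth M (A d) c)) ds)"
  show thesis
  proof
    show "B \<in> plus_formulae I PV"
      unfolding B_def using A(1) ds by (auto intro!: Conj_plus has_value_plus)
    show "truth M B c = top"
      by (simp add: B_def truth_Conj truth_has_value image_image biimp_refl)
    fix d assume "d \<in> D"
    then have "truth M' B d \<le> biimp (truth M' (A d) d) (truth M (A d) c)"
      unfolding B_def truth_Conj using ds by (auto simp: truth_has_value intro!: INF_lower2)
    also have "\<dots> < t"
      using A(2)[OF \<open>d \<in> D\<close>] by (simp add: biimp_commute)
    finally show "truth M' B d < t" .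
  qed
qed

lemma agreement_forth:
  fixes M :: "('w, 'i, 'p, 'h::{complete_heyting_algebra, complete_linorder}) kripke"
    and M' :: "('v, 'i, 'p, 'h) kripke"
    and PV :: "'p set"
  assumes "image_finite I M'" and "i \<in> I"
  defines "\<phi> \<equiv> agreement (plus_formulae I PV) M M'"
  shows "finv \<phi> \<circ>\<^sub>r\<^sub>r rel M i \<le> rel M' i \<circ>\<^sub>r\<^sub>r finv \<phi>"
  unfolding forth_iff
proof (intro allI, rule ccontr)
  fix a b c
  define t where "t = inf (\<phi> a b) (rel M i a c)"
  define s where "s = (SUP d. inf (rel M' i b d) (\<phi> c d))"
  assume "\<not> inf (\<phi> a b) (rel M i a c) \<le> (SUP d. inf (rel M' i b d) (\<phi> c d))"
  then have "s < t"
    by (simp add: s_def t_def)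
  then have "bot < t"
    by (rule le_less_trans[OF bot_least])
  have fin: "finite {d. rel M' i b d > bot}"
    using assms by (simp add: image_finite_def)
  have unmatched: "inf (rel M' i b d) (\<phi> c d) < t" for d
  proof -
    have "inf (rel M' i b d) (\<phi> c d) \<le> s"
      unfolding s_def by (rule SUP_upper) simp
    then show ?thesis
      using \<open>s < t\<close> by (rule le_less_trans)
  qed
  \<comment> \<open>The successors to degree at least \<open>t\<close> are the only ones that have to be separated from \<open>c\<close>:
    the others contribute less than \<open>t\<close> to the value of any diamond at \<open>b\<close>.\<close>
  define D where "D = {d. t \<le> rel M' i b d}"
  have "finite D"
    by (rule finite_subset[OF _ fin]) (use \<open>bot < t\<close> in \<open>auto simp: D_def\<close>)
  moreover have "agreement (plus_formulae I PV) M M' c d < t" if "d \<in> D" for d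
    using unmatched[of d] that unfolding D_def \<phi>_def by (metis le_infI mem_Collect_eq not_le)
  ultimately obtain B where B: "B \<in> plus_formulae I PV" "truth M B c = top"
      "\<And>d. d \<in> D \<Longrightarrow> truth M' B d < t"
    using characteristic_formula by metis
  have "rel M i a c \<le> truth M (Dia i B) a"
    using SUP_upper[of c UNIV "\<lambda>u. inf (rel M i a u) (truth M B u)"] B(2) by simp
  then have "t \<le> inf (\<phi> a b) (truth M (Dia i B) a)"
    unfolding t_def by (intro inf_mono order.refl)
  also have "Dia i B \<in> plus_formulae I PV"
    using B(1) \<open>i \<in> I\<close> by (simp add: plus_formulae_def formulae_def)
  then have "inf (\<phi> a b) (truth M (Dia i B) a) \<le> truth M' (Dia i B) b"
    unfolding \<phi>_def by (rule agreement_preserves_truth)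
  finally have le: "t \<le> (SUP d. inf (rel M' i b d) (truth M' B d))"
    by simp
  have "finite {d. inf (rel M' i b d) (truth M' B d) > bot}"
    by (rule finite_subset[OF _ fin]) (auto intro: less_le_trans)
  then obtain d where "t \<le> inf (rel M' i b d) (truth M' B d)"
    using \<open>bot < t\<close> le by (rule le_SUP_attained)
  then show False
    using B(3)[of d] by (auto simp: D_def)
qed

lemma agreement_forward_prebisimulation:
  fixes M :: "('w, 'i, 'p, 'h::{complete_heyting_algebra, complete_linorder}) kripke"
    and M' :: "('v, 'i, 'p, 'h) kripke"
  assumes "image_finite I M" and "image_finite I M'"
    and weak: "weak_prebisimulation (plus_formulae I PV) M M' (agreement (plus_formulae I PV) M M')"
  shows "forward_prebisimulation I PV M M' (agreement (plus_formulae I PV) M M')"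
proof -
  have "Letter p \<in> plus_formulae I PV" if "p \<in> PV" for p
    using that by (simp add: plus_formulae_def formulae_def)
  moreover note agreement_forth[OF assms(2), of _ PV M]
  \<comment> \<open>The back condition is the forth condition with the two models exchanged.\<close>
  moreover have "agreement (plus_formulae I PV) M M' \<circ>\<^sub>r\<^sub>r rel M' i
      \<le> rel M i \<circ>\<^sub>r\<^sub>r agreement (plus_formulae I PV) M M'" if "i \<in> I" for i
    using agreement_forth[OF assms(1) that, of PV M'] by (simp add: finv_agreement)
  ultimately show ?thesis
    using weak unfolding forward_prebisimulation_def weak_prebisimulation_def by blast
qed

section \<open>Greatest weak and greatest forward bisimulations\<close>

theorem theorem2:
  fixes I :: "'i set" and PV :: "'p set"
    and M :: "('w, 'i, 'p, 'h::{complete_heyting_algebra, complete_linorder}) kripke"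
    and M' :: "('v, 'i, 'p, 'h) kripke"
  assumes "finite I"
    and "image_finite I M" and "image_finite I M'"
  shows "(\<forall>\<phi>. is_greatest (weak_prebisimulation (plus_formulae I PV) M M') \<phi>
            \<longrightarrow> is_greatest (forward_prebisimulation I PV M M') \<phi>) \<and>
         (\<forall>\<phi>. is_greatest (weak_bisimulation PV (plus_formulae I PV) M M') \<phi>
            \<longrightarrow> is_greatest (forward_bisimulation I PV M M') \<phi>)"
proof (intro conjI allI impI)
  let ?\<Psi> = "plus_formulae I PV"
  fix \<phi>
  assume greatest: "is_greatest (weak_prebisimulation ?\<Psi> M M') \<phi>"
  then have "\<phi> = agreement ?\<Psi> M M'"
    by (rule greatest_weak_prebisimulation_eq_agreement)
  then have "forward_prebisimulation I PV M M' \<phi>"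
    using greatest agreement_forward_prebisimulation[OF assms(2,3)] by (simp add: is_greatest_def)
  then show "is_greatest (forward_prebisimulation I PV M M') \<phi>"
    using greatest forward_imp_weak_prebisimulation unfolding is_greatest_def by blast
next
  let ?\<Psi> = "plus_formulae I PV"
  fix \<phi>
  assume greatest: "is_greatest (weak_bisimulation PV ?\<Psi> M M') \<phi>"
  then have "\<phi> = agreement ?\<Psi> M M'"
    by (rule greatest_weak_bisimulation_eq_agreement)
  then have "forward_bisimulation I PV M M' \<phi>"
    using greatest agreement_forward_prebisimulation[OF assms(2,3)]
    by (simp add: is_greatest_def weak_bisimulation_def forward_bisimulation_def)
  moreover have "weak_bisimulation PV ?\<Psi> M M' \<psi>" if "forward_bisimulation I PV M M' \<psi>" for \<psi>
    using that forward_imp_weak_prebisimulation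
    by (auto simp: weak_bisimulation_def forward_bisimulation_def)
  ultimately show "is_greatest (forward_bisimulation I PV M M') \<phi>"
    using greatest unfolding is_greatest_def by blast
qed

end
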